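(* Let $n\ge1$ be an integer and $a,b>0$. The collision sequence $(21)^n$ is allowed as a capture process for mass ratios $(m_1/m_2,m_3/m_2)=(a,b)$ if and only if $(32)^n$ is allowed as a capture process for mass ratios $(m_1/m_2,m_3/m_2)=(b,a)$. Likewise, $(21)^n(2)$ is allowed for $(a,b)$ if and only if $(2)(32)^n$ is allowed for $(b,a)$. That is, the allowed regions of $(21)^n$ and $(21)^n(2)$ in the $(a,b)$ quadrant are the reflections about the line $b=a$ of the allowed regions of $(32)^n$ and $(2)(32)^n$, respectively.
   Context: Setting: three point particles 1, 2, 3 move in the plane, identified with $\mathbb{C}$, with masses $m_1,m_2,m_3>0$; put $a=m_1/m_2$, $b=m_3/m_2$. Between collisions particles move freely with constant velocity. A collision "$(i)$", $i\in\{1,2,3\}$, is a collision between the two particles other than $i$ (the spectator): the two particles are at the same position with nonzero relative velocity, and instantaneously their velocities change so that their total momentum is conserved and their relative velocity is multiplied by a complex number $x=e^{i\alpha}$, $|x|=1$ (so kinetic energy is conserved); the spectator's velocity is unchanged. The number $x$ (the scattering angle $\alpha$) may be any unit complex number and may be chosen independently at each collision. A collision sequence is written as a string in order of occurrence from left to right; e.g. $(21)^n(2)$ is $(2)(1)(2)(1)\cdots(2)(1)(2)$ with $2n+1$ collisions. The times between successive collisions are required to be strictly positive, and no other interactions occur. Capture process: initially particles 2 and 3 are at rest at distinct points, and particle 1 has a nonzero velocity. A collision sequence is allowed as a capture process for $(a,b)$ if there exist initial positions and velocity of particle 1, initial positions of 2 and 3, and scattering angles such that the collisions of the sequence occur in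 that order, and after the last collision particles 1 and 2 have equal velocities. The allowed region of a sequence is the set of $(a,b)$, $a,b>0$, for which it is allowed. *)

theory Defs
  imports Complex_Main
begin

datatype particle = P1 | P2 | P3

text \<open>A collision is named by its spectator: the letter \<open>i\<close> in a collision sequence stands for a
  collision of the two particles other than \<open>i\<close>. Sequences are lists in order of occurrence.\<close>

type_synonym collision_seq = "particle list"

definition seq_power :: "collision_seq \<Rightarrow> nat \<Rightarrow> collision_seq" where
  "seq_power cs n = concat (replicate n cs)"

text \<open>\<open>u\<close> and \<open>w\<close> are the velocities of the particles just before and just after a collision with
  spectator \<open>i\<close>; \<open>x\<close> is \<open>exp (\<i> * \<alpha>)\<close> for the scattering angle \<open>\<alpha>\<close>.\<close>

definition scatters ::
  "(particle \<Rightarrow> real) \<Rightarrow> particle \<Rightarrow> complex \<Rightarrow> (particle \<Rightarrow> complex) \<Rightarrow> (particle \<Rightarrow> complex) \<Rightarrow> bool" where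
  "scatters m i x u w \<longleftrightarrow>
     cmod x = 1 \<and> w i = u i \<and>
     (\<forall>j k. distinct [i, j, k] \<longrightarrow>
        u j \<noteq> u k \<and>
        of_real (m j) * w j + of_real (m k) * w k = of_real (m j) * u j + of_real (m k) * u k \<and>
        w j - w k = x * (u j - u k))"

text \<open>The motion starts at time \<open>t 0 = 0\<close>; the collision \<open>cs ! k\<close> takes place at time \<open>t (Suc k)\<close>.
  \<open>q i s\<close> is the position of particle \<open>i\<close> at time \<open>s\<close>, and \<open>v k i\<close> is its velocity after the first
  \<open>k\<close> collisions. Particles interact only by contact, and \<open>x = 1\<close> is an admissible scattering, so
  ``no other interactions'' says that from the start up to and including the last collision any two
  particles are at the same position only when they undergo a collision of the sequence; in
  particular the spectator of a collision is away from the colliding pair.\<close>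

definition motion ::
  "(particle \<Rightarrow> real) \<Rightarrow> collision_seq \<Rightarrow> (particle \<Rightarrow> real \<Rightarrow> complex) \<Rightarrow>
   (nat \<Rightarrow> particle \<Rightarrow> complex) \<Rightarrow> (nat \<Rightarrow> real) \<Rightarrow> bool" where
  "motion m cs q v t \<longleftrightarrow>
     t 0 = 0 \<and>
     (\<forall>k < length cs. t k < t (Suc k)) \<and>
     (\<forall>k < length cs. \<forall>i. \<forall>s \<in> {t k..t (Suc k)}.
        q i s = q i (t k) + of_real (s - t k) * v k i) \<and>
     (\<forall>k < length cs. \<forall>i j. distinct [cs ! k, i, j] \<longrightarrow> q i (t (Suc k)) = q j (t (Suc k))) \<and>
     (\<forall>k < length cs. \<exists>x. scatters m (cs ! k) x (v k) (v (Suc k))) \<and>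
     (\<forall>s \<in> {0..t (length cs)}. \<forall>i j. i \<noteq> j \<and> q i s = q j s \<longrightarrow>
        (\<exists>k < length cs. s = t (Suc k) \<and> distinct [cs ! k, i, j]))"

definition capture_process ::
  "(particle \<Rightarrow> real) \<Rightarrow> collision_seq \<Rightarrow> (particle \<Rightarrow> real \<Rightarrow> complex) \<Rightarrow>
   (nat \<Rightarrow> particle \<Rightarrow> complex) \<Rightarrow> (nat \<Rightarrow> real) \<Rightarrow> bool" where
  "capture_process m cs q v t \<longleftrightarrow>
     motion m cs q v t \<and>
     v 0 P2 = 0 \<and> v 0 P3 = 0 \<and> q P2 0 \<noteq> q P3 0 \<and> v 0 P1 \<noteq> 0 \<and>
     v (length cs) P1 = v (length cs) P2"

definition capture_allowed :: "collision_seq \<Rightarrow> real \<Rightarrow> real \<Rightarrow> bool" where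
  "capture_allowed cs a b \<longleftrightarrow>
     (\<exists>m. (\<forall>i. m i > 0) \<and> m P1 / m P2 = a \<and> m P3 / m P2 = b \<and>
          (\<exists>q v t. capture_process m cs q v t))"

definition allowed_region :: "collision_seq \<Rightarrow> (real \<times> real) set" where
  "allowed_region cs = {(a, b). a > 0 \<and> b > 0 \<and> capture_allowed cs a b}"

end

(* Run a capture process backwards, starting shortly after its last collision, exchange the labels
   1 and 3, and change to the inertial frame in which the captured pair is at rest. The final
   condition "1 and 2 have equal velocities" becomes the initial condition "2 and 3 are at rest",
   and conversely, so the result is a capture process for the reversed and relabelled sequence with
   the masses of 1 and 3 exchanged. This operation is an involution. *)

theory Submission
  imports Defs
begin

section \<open>Exchange of the labels 1 and 3\<close>

fun swap13 :: "particle \<Rightarrow> particle" where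
  "swap13 P1 = P3"
| "swap13 P2 = P2"
| "swap13 P3 = P1"

lemma swap13_swap13 [simp]: "swap13 (swap13 i) = i"
  by (cases i) auto

lemma swap13_eq_iff [simp]: "swap13 i = swap13 j \<longleftrightarrow> i = j"
  by (metis swap13_swap13)

lemma distinct_swap13_iff:
  "distinct [swap13 i, j, k] \<longleftrightarrow> distinct [i, swap13 j, swap13 k]"
  by (cases i; cases j; cases k) auto

lemma finite_UNIV_particle: "finite (UNIV :: particle set)"
proof -
  have "(UNIV :: particle set) = {P1, P2, P3}"
    using particle.exhaust by auto
  thus ?thesis by (metis finite.emptyI finite.insertI)
qed

lemma exists_distinct_particles: "\<exists>j k. distinct [i :: particle, j, k]"
proof (cases i)
  case P1
  then have "distinct [i, P2, P3]" by simp
  then show ?thesis by blast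
next
  case P2
  then have "distinct [i, P1, P3]" by simp
  then show ?thesis by blast
next
  case P3
  then have "distinct [i, P1, P2]" by simp
  then show ?thesis by blast
qed

section \<open>Time reversal of a single collision\<close>

text \<open>A factor of modulus 1 cannot annihilate the relative velocity. This yields the nonzero
  incoming relative velocity of the reversed collision.\<close>

lemma scatters_final_neq:
  assumes "scatters m i x u w" "distinct [i, j, k]"
  shows "w j \<noteq> w k"
proof -
  have "cmod x = 1" "u j \<noteq> u k" "w j - w k = x * (u j - u k)"
    using assms unfolding scatters_def by blast+
  thus ?thesis by auto
qed

text \<open>Reversal negates velocities and the change of frame adds \<open>c\<close>. The shift
  cancels in relative velocities and contributes equally to the momentum before and after;
  exchanging before and after inverts the unit factor \<open>x\<close>.\<close>

lemma scatters_reverse: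
  assumes "scatters m i x u w"
  shows "scatters (m \<circ> swap13) (swap13 i) (inverse x)
           (\<lambda>j. c - w (swap13 j)) (\<lambda>j. c - u (swap13 j))"
  unfolding scatters_def
proof (intro conjI allI impI)
  show "cmod (inverse x) = 1"
    using assms by (simp add: scatters_def norm_inverse)
  show "c - u (swap13 (swap13 i)) = c - w (swap13 (swap13 i))"
    using assms by (simp add: scatters_def)
  fix j k assume d: "distinct [swap13 i, j, k]"
  define j' k' where "j' = swap13 j" and "k' = swap13 k"
  have d': "distinct [i, j', k']"
    using d unfolding distinct_swap13_iff j'_def k'_def .
  have x: "x \<noteq> 0"
    using assms[unfolded scatters_def, THEN conjunct1] by auto
  have mom: "of_real (m j') * w j' + of_real (m k') * w k' =
        of_real (m j') * u j' + of_real (m k') * u k'"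
    and rel: "w j' - w k' = x * (u j' - u k')"
    using assms d' unfolding scatters_def by blast+
  show "c - w (swap13 j) \<noteq> c - w (swap13 k)"
    using scatters_final_neq[OF assms d'] by (simp add: j'_def k'_def)
  show "of_real ((m \<circ> swap13) j) * (c - u (swap13 j)) + of_real ((m \<circ> swap13) k) * (c - u (swap13 k)) =
        of_real ((m \<circ> swap13) j) * (c - w (swap13 j)) + of_real ((m \<circ> swap13) k) * (c - w (swap13 k))"
    using mom by (simp add: j'_def k'_def algebra_simps)
  have "u k' - u j' = inverse x * (w k' - w j')"
    using x rel by (simp add: field_simps)
  thus "c - u (swap13 j) - (c - u (swap13 k)) =
        inverse x * (c - w (swap13 j) - (c - w (swap13 k)))"
    by (simp add: j'_def k'_def)
qed

section \<open>Continuation of a motion past its last collision\<close>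

text \<open>An affine function of \<open>s\<close> that is not identically zero has at most one
  zero, so a positive zero \<open>r\<close> leaves the interval from 0 to \<open>r\<close> free of
  zeros.\<close>

lemma eventually_at_right_affine_nonzero:
  fixes d w :: complex
  assumes "d \<noteq> 0 \<or> w \<noteq> 0"
  shows "eventually (\<lambda>s::real. d + of_real s * w \<noteq> 0) (at_right 0)"
proof (cases "\<exists>s>0. d + of_real s * w = 0")
  case True
  then obtain r :: real where r: "r > 0" "d + of_real r * w = 0" by blast
  with assms have w: "w \<noteq> 0" by auto
  have "d + of_real s * w \<noteq> 0" if "s < r" for s :: real
  proof
    assume "d + of_real s * w = 0"
    with r have "of_real s * w = of_real r * w" by (metis add_left_cancel)
    with w that show False by simp
  qed
  with r(1) show ?thesis
    by (auto simp: eventually_at_right_field)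
next
  case False
  then show ?thesis
    by (auto simp: eventually_at_right_field intro: exI[of _ 1])
qed

lemma motion_scatters:
  assumes "motion m cs q v t" "k < length cs"
  obtains x where "scatters m (cs ! k) x (v k) (v (Suc k))"
  using assms unfolding motion_def by blast

lemma motion_times_mono:
  assumes "motion m cs q v t" "k \<le> l" "l \<le> length cs"
  shows "t k \<le> t l"
  using assms(2,3)
proof (induction l rule: dec_induct)
  case base
  show ?case by simp
next
  case (step l)
  moreover have "t l < t (Suc l)" using assms(1) step unfolding motion_def by simp
  ultimately show ?case by simp
qed

text \<open>A motion is specified only up to its last collision; the reversed motion has to start
  strictly before its first one, at a time at which the particles are apart.\<close>

lemma motion_extend:
  assumes mot: "motion m cs q v t" and ne: "cs \<noteq> []"
  defines "N \<equiv> length cs"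
  obtains T where "t N < T"
    and "\<And>s i j. t N < s \<Longrightarrow> s \<le> T \<Longrightarrow> i \<noteq> j \<Longrightarrow>
           q i (t N) + of_real (s - t N) * v N i \<noteq> q j (t N) + of_real (s - t N) * v N j"
proof -
  have t0: "t 0 = 0" and step: "\<And>k. k < N \<Longrightarrow> t k < t (Suc k)"
    using mot by (auto simp: motion_def N_def)
  have mono: "t k \<le> t l" if "k \<le> l" "l \<le> N" for k l using motion_times_mono[OF mot] that unfolding N_def by blast
  \<comment> \<open>If both positions and velocities of two particles agreed at \<open>t N\<close>,
    the coincidence would be the last collision, after which the pair has nonzero relative
    velocity.\<close>
  have "q i (t N) - q j (t N) \<noteq> 0 \<or> v N i - v N j \<noteq> 0" if "i \<noteq> j" for i j
  proof (rule ccontr)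
    assume *: "\<not> ?thesis"
    have "t N \<in> {0..t N}" using mono[of 0 N] t0 by simp
    with * that mot obtain k where k: "k < N" "t N = t (Suc k)" "distinct [cs ! k, i, j]"
      unfolding motion_def N_def by (metis eq_iff_diff_eq_0)
    have "Suc k = N"
    proof (rule ccontr)
      assume "Suc k \<noteq> N"
      then have "Suc k < N" using k(1) by simp
      then show False using step[of "Suc k"] mono[of "Suc (Suc k)" N] k(2) by simp
    qed
    obtain x where "scatters m (cs ! k) x (v k) (v (Suc k))"
      using motion_scatters[OF mot] k(1) unfolding N_def by blast
    from scatters_final_neq[OF this k(3)] \<open>Suc k = N\<close> * show False by simp
  qed
  then have "eventually (\<lambda>s. \<forall>i\<in>UNIV. \<forall>j\<in>UNIV. i \<noteq> j \<longrightarrow>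
      (q i (t N) - q j (t N)) + of_real s * (v N i - v N j) \<noteq> 0) (at_right (0::real))"
    by (intro eventually_ball_finite finite_UNIV_particle ballI)
       (use eventually_at_right_affine_nonzero in \<open>auto intro: eventually_mono\<close>)
  then obtain e :: real where e: "e > 0"
    "\<And>s i j. 0 < s \<Longrightarrow> s < e \<Longrightarrow> i \<noteq> j \<Longrightarrow>
       (q i (t N) - q j (t N)) + of_real s * (v N i - v N j) \<noteq> 0"
    by (auto simp: eventually_at_right_field)
  show thesis
  proof
    \<comment> \<open>Half of \<open>e\<close>, because \<open>e\<close> itself is excluded while
      \<open>T\<close> must be included.\<close>
    show "t N < t N + e / 2" using e(1) by simp
    fix s i j assume s: "t N < s" "s \<le> t N + e / 2" and ij: "(i :: particle) \<noteq> j"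
    have "(q i (t N) - q j (t N)) + of_real (s - t N) * (v N i - v N j) \<noteq> 0"
      using e s ij by (intro e(2)) auto
    then show "q i (t N) + of_real (s - t N) * v N i \<noteq> q j (t N) + of_real (s - t N) * v N j"
      by (auto simp: algebra_simps)
  qed
qed

section \<open>Time reversal of a whole motion\<close>

text \<open>After \<open>k\<close> reversed collisions the first \<open>N - k\<close> original ones
  are still to be undone, hence the index \<open>N - k\<close>. The initial separation provides the
  distinct starting points of 2 and 3 in a capture process.\<close>

lemma motion_reverse:
  fixes c :: complex
  assumes mot: "motion m cs q v t" and ne: "cs \<noteq> []"
  defines "N \<equiv> length cs"
  obtains q' t' where
    "motion (m \<circ> swap13) (map swap13 (rev cs)) q' (\<lambda>k i. c - v (N - k) (swap13 i)) t'"
    and "\<And>i j. i \<noteq> j \<Longrightarrow> q' i 0 \<noteq> q' j 0"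
proof -
  have t0: "t 0 = 0"
    and step: "\<forall>k<N. t k < t (Suc k)"
    and lin: "\<forall>k<N. \<forall>i. \<forall>s\<in>{t k..t (Suc k)}. q i s = q i (t k) + of_real (s - t k) * v k i"
    and coll: "\<forall>k<N. \<forall>i j. distinct [cs ! k, i, j] \<longrightarrow> q i (t (Suc k)) = q j (t (Suc k))"
    and scat: "\<forall>k<N. \<exists>x. scatters m (cs ! k) x (v k) (v (Suc k))"
    and only: "\<forall>s\<in>{0..t N}. \<forall>i j. i \<noteq> j \<and> q i s = q j s \<longrightarrow>
        (\<exists>k<N. s = t (Suc k) \<and> distinct [cs ! k, i, j])"
    using mot[unfolded motion_def, folded N_def] by - (elim conjE, assumption)+
  have "N > 0" using ne by (simp add: N_def)
  obtain T where T: "t N < T" and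
    apart: "\<And>s i j. t N < s \<Longrightarrow> s \<le> T \<Longrightarrow> i \<noteq> j \<Longrightarrow>
           q i (t N) + of_real (s - t N) * v N i \<noteq> q j (t N) + of_real (s - t N) * v N j"
    using motion_extend[OF mot ne] unfolding N_def by metis
  \<comment> \<open>\<open>T\<close> is appended as the time with index \<open>N + 1\<close>, so
    that the free flight after the last collision is a stretch like the others; \<open>Q\<close>
    continues \<open>q\<close> along it.\<close>
  define \<tau> where "\<tau> j = (if j \<le> N then t j else T)" for j
  define Q where "Q i s = (if s \<le> t N then q i s else q i (t N) + of_real (s - t N) * v N i)" for i s
  have \<tau>_step: "\<tau> j < \<tau> (Suc j)" if "j \<le> N" for j
    using that step[rule_format, of j] T by (cases "j = N") (simp_all add: \<tau>_def)
  have t_mono: "t k \<le> t l" if "k \<le> l" "l \<le> N" for k l using motion_times_mono[OF mot] that unfolding N_def by blast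
  have Q_lin: "Q i s = Q i (\<tau> j) + of_real (s - \<tau> j) * v j i"
    if "j \<le> N" "\<tau> j \<le> s" "s \<le> \<tau> (Suc j)" for i j s
  proof (cases "j = N")
    case True
    then show ?thesis using that by (simp add: Q_def \<tau>_def)
  next
    case False
    then have j: "j < N" using that by simp
    then have "t (Suc j) \<le> t N" "t j \<le> t N" using t_mono by auto
    then show ?thesis using that j lin[rule_format, of j s i] by (simp add: Q_def \<tau>_def)
  qed
  have Q_apart: "Q i s \<noteq> Q j s" if "t N < s" "s \<le> T" "i \<noteq> j" for i j s
    using apart[of s i j] that by (auto simp: Q_def)
  define t' where "t' k = T - \<tau> (Suc N - k)" for k
  define q' where "q' i s = Q (swap13 i) (T - s) + of_real s * c" for i s
  have nth: "map swap13 (rev cs) ! k = swap13 (cs ! (N - Suc k))" if "k < N" for k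
    using that by (simp add: N_def rev_nth)
  have "motion (m \<circ> swap13) (map swap13 (rev cs)) q' (\<lambda>k i. c - v (N - k) (swap13 i)) t'"
    unfolding motion_def length_map length_rev N_def[symmetric]
  proof (intro conjI allI impI ballI)
    show "t' 0 = 0" by (simp add: t'_def \<tau>_def)
    fix k assume k: "k < N"
    show "t' k < t' (Suc k)"
      using \<tau>_step[of "N - k"] k by (simp add: t'_def Suc_diff_le)
  next
    fix k i s assume k: "k < N" and s: "s \<in> {t' k..t' (Suc k)}"
    define j where "j = N - k"
    have j: "j \<le> N" "Suc N - k = Suc j" "Suc N - Suc k = j" using k by (auto simp: j_def)
    have "Q (swap13 i) (T - s) = Q (swap13 i) (\<tau> j) + of_real (T - s - \<tau> j) * v j (swap13 i)"
      by (rule Q_lin) (use s j in \<open>auto simp: t'_def\<close>)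
    \<comment> \<open>The reversed stretch begins at \<open>\<tau> (Suc j)\<close>, so the position
      has to be expressed from the right end instead of the left.\<close>
    moreover have "Q (swap13 i) (\<tau> j) =
        Q (swap13 i) (\<tau> (Suc j)) - of_real (\<tau> (Suc j) - \<tau> j) * v j (swap13 i)"
      using Q_lin[of j "\<tau> (Suc j)" "swap13 i"] \<tau>_step[of j] j by simp
    ultimately show "q' i s = q' i (t' k) + of_real (s - t' k) * (c - v (N - k) (swap13 i))"
      unfolding q'_def t'_def j j_def[symmetric] by (simp add: algebra_simps)
  next
    fix k i j assume k: "k < N" and d: "distinct [map swap13 (rev cs) ! k, i, j]"
    have "distinct [cs ! (N - Suc k), swap13 i, swap13 j]"
      using d unfolding nth[OF k] distinct_swap13_iff .
    from coll[rule_format, OF _ this] k have "q (swap13 i) (t (N - k)) = q (swap13 j) (t (N - k))"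
      by (simp add: Suc_diff_Suc)
    moreover have "t (N - k) \<le> t N" by (rule t_mono) auto
    ultimately show "q' i (t' (Suc k)) = q' j (t' (Suc k))"
      by (simp add: q'_def t'_def Q_def \<tau>_def)
  next
    fix k assume k: "k < N"
    obtain x where "scatters m (cs ! (N - Suc k)) x (v (N - Suc k)) (v (Suc (N - Suc k)))"
      using scat[rule_format, of "N - Suc k"] k by auto
    from scatters_reverse[OF this, of c] k
    show "\<exists>x. scatters (m \<circ> swap13) (map swap13 (rev cs) ! k) x
        (\<lambda>i. c - v (N - k) (swap13 i)) (\<lambda>i. c - v (N - Suc k) (swap13 i))"
      using nth[OF k] by (auto simp: Suc_diff_Suc)
  next
    fix s i j assume s: "s \<in> {0..t' N}" and ij: "i \<noteq> j \<and> q' i s = q' j s"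
    have eq: "Q (swap13 i) (T - s) = Q (swap13 j) (T - s)" using ij by (simp add: q'_def)
    \<comment> \<open>The continuation after \<open>t N\<close> has no coincidences, so this one
      belongs to the original motion and is one of its collisions.\<close>
    have "T - s \<le> t N"
      using Q_apart[of "T - s" "swap13 i" "swap13 j"] eq ij s by force
    moreover have "0 \<le> T - s"
      using s t_mono[of 0 1] t0 \<open>N > 0\<close> by (auto simp: t'_def \<tau>_def)
    ultimately obtain k where k: "k < N" "T - s = t (Suc k)"
        "distinct [cs ! k, swap13 i, swap13 j]"
      using only[rule_format, of "T - s" "swap13 i" "swap13 j"] eq ij by (auto simp: Q_def)
    define k' where "k' = N - Suc k"
    have k': "k' < N" "N - Suc k' = k" "N - k' = Suc k" using k(1) by (auto simp: k'_def)
    have "s = t' (Suc k')" using k k' by (simp add: t'_def \<tau>_def)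
    moreover have "distinct [map swap13 (rev cs) ! k', i, j]"
      using k(3) unfolding nth[OF k'(1)] k'(2) distinct_swap13_iff .
    ultimately show "\<exists>k<N. s = t' (Suc k) \<and> distinct [map swap13 (rev cs) ! k, i, j]"
      using k'(1) by blast
  qed
  moreover have "q' i 0 \<noteq> q' j 0" if "i \<noteq> j" for i j
    using Q_apart[of T "swap13 i" "swap13 j"] T that by (simp add: q'_def)
  ultimately show thesis by (rule that)
qed

section \<open>Reversal of capture processes and reflection of allowed regions\<close>

text \<open>With \<open>c\<close> the final velocity \<open>v N P2\<close> of the captured pair, the
  new 2 and 3 (old 2 and 1) start at rest; the new 1 and 2 (old 3 and 2) end with common velocity
  \<open>v N P2\<close>, since the old ones started at rest.\<close>

lemma capture_allowed_reverse:
  assumes "capture_allowed cs a b"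
  shows "capture_allowed (map swap13 (rev cs)) b a"
proof -
  obtain m q v t where m: "\<And>i. m i > 0" "m P1 / m P2 = a" "m P3 / m P2 = b"
    and cap: "capture_process m cs q v t"
    using assms unfolding capture_allowed_def by blast
  define N where "N = length cs"
  have mot: "motion m cs q v t" and v0: "v 0 P2 = 0" "v 0 P3 = 0" "v 0 P1 \<noteq> 0"
    and vN: "v N P1 = v N P2"
    using cap by (auto simp: capture_process_def N_def)
  \<comment> \<open>With no collision, particle 1 would keep its nonzero velocity and yet share the
    zero velocity of particle 2.\<close>
  have ne: "cs \<noteq> []" using v0 vN by (auto simp: N_def)
  \<comment> \<open>This gives the new particle 1 its nonzero initial velocity. Otherwise all three
    final velocities would agree, but the pair of the last collision leaves it with different
    ones.\<close>
  have "v N P3 \<noteq> v N P2"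
  proof
    assume "v N P3 = v N P2"
    with vN have all: "v N i = v N P2" for i by (cases i) auto
    have "N - 1 < N" "Suc (N - 1) = N" using ne by (auto simp: N_def)
    then obtain x where "scatters m (cs ! (N - 1)) x (v (N - 1)) (v N)"
      using motion_scatters[OF mot, of "N - 1"] unfolding N_def by auto
    moreover obtain j k where "distinct [cs ! (N - 1), j, k]"
      using exists_distinct_particles by blast
    ultimately show False using scatters_final_neq all by metis
  qed
  obtain q' t' where mot': "motion (m \<circ> swap13) (map swap13 (rev cs)) q'
      (\<lambda>k i. v N P2 - v (N - k) (swap13 i)) t'"
    and apart: "\<And>i j. i \<noteq> j \<Longrightarrow> q' i 0 \<noteq> q' j 0"
    using motion_reverse[OF mot ne] unfolding N_def by metis
  have "capture_process (m \<circ> swap13) (map swap13 (rev cs)) q'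
      (\<lambda>k i. v N P2 - v (N - k) (swap13 i)) t'"
    using mot' apart[of P2 P3] v0 vN \<open>v N P3 \<noteq> v N P2\<close>
    by (auto simp: capture_process_def N_def)
  moreover have "\<forall>i. (m \<circ> swap13) i > 0" "(m \<circ> swap13) P1 / (m \<circ> swap13) P2 = b"
      "(m \<circ> swap13) P3 / (m \<circ> swap13) P2 = a"
    using m by simp_all
  ultimately show ?thesis unfolding capture_allowed_def by blast
qed

lemma capture_allowed_reverse_iff:
  "capture_allowed cs a b \<longleftrightarrow> capture_allowed (map swap13 (rev cs)) b a"
proof
  assume "capture_allowed (map swap13 (rev cs)) b a"
  from capture_allowed_reverse[OF this] show "capture_allowed cs a b"
    by (simp add: rev_map o_def)
qed (rule capture_allowed_reverse)

lemma allowed_region_reverse: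
  "allowed_region cs = prod.swap ` allowed_region (map swap13 (rev cs))"
proof -
  have "p \<in> allowed_region cs \<longleftrightarrow> prod.swap p \<in> allowed_region (map swap13 (rev cs))" for p
    using capture_allowed_reverse_iff[of cs] by (cases p) (auto simp: allowed_region_def)
  then show ?thesis by (force simp: image_iff)
qed

lemma map_swap13_rev_seq_power:
  "map swap13 (rev (seq_power cs n)) = seq_power (map swap13 (rev cs)) n"
  by (simp add: seq_power_def rev_concat map_concat)

theorem mainTheorem3:
  fixes n :: nat and a b :: real
  assumes "n \<ge> 1" and "a > 0" and "b > 0"
  shows "(capture_allowed (seq_power [P2, P1] n) a b \<longleftrightarrow>
            capture_allowed (seq_power [P3, P2] n) b a) \<and>
         (capture_allowed (seq_power [P2, P1] n @ [P2]) a b \<longleftrightarrow>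
            capture_allowed ([P2] @ seq_power [P3, P2] n) b a) \<and>
         allowed_region (seq_power [P2, P1] n) =
            prod.swap ` allowed_region (seq_power [P3, P2] n) \<and>
         allowed_region (seq_power [P2, P1] n @ [P2]) =
            prod.swap ` allowed_region ([P2] @ seq_power [P3, P2] n)"
proof -
  \<comment> \<open>Reversing \<open>[P2, P1]\<close> gives \<open>[P1, P2]\<close>, relabelled
    \<open>[P3, P2]\<close>; a final \<open>P2\<close> keeps its label and moves to the
    front.\<close>
  have "map swap13 (rev (seq_power [P2, P1] n)) = seq_power [P3, P2] n"
    and "map swap13 (rev (seq_power [P2, P1] n @ [P2])) = [P2] @ seq_power [P3, P2] n"
    by (simp_all add: map_swap13_rev_seq_power)
  then show ?thesis
    by (metis capture_allowed_reverse_iff allowed_region_reverse)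
qed

end
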